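(* Let $k\in\mathbb{N}$, $k\ge 1$, and let $m\ge 0$ be an integer. Then $$D_m^{(k)} = m!\, b_m^{(-k)}.$$
   Context: All identities are of formal power series in $t$. The Daehee numbers of the first kind of order $k$ are defined by $$\sum_{n=0}^\infty D_n^{(k)}\frac{t^n}{n!} = \left(\frac{\log(1+t)}{t}\right)^k .$$ The Nörlund numbers of the second kind $b_n^{(x)}$ are defined, for any number $x$, by $$\left(\frac{t}{\log(1+t)}\right)^x = \sum_{n=0}^\infty b_n^{(x)} t^n$$ (the $x$-th power of a power series with constant term $1$); $b_n^{(-k)}$ is the value at $x=-k$. *)

theory Defs
  imports "HOL-Computational_Algebra.Formal_Power_Series"
begin

unbundle fps_syntax

text \<open>
  The power \<open>f\<^sup>x\<close>, for \<open>x\<close> in the coefficient field, of a power series \<open>f\<close> with constant term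
  \<open>1\<close>: the binomial series \<open>(1 + u)\<^sup>x = (\<Sum>n. (x gchoose n) u\<^sup>n)\<close> at \<open>u = f - 1\<close>. The
  value is only meaningful if \<open>f $ 0 = 1\<close>.
\<close>

definition fps_general_power :: "'a::field_char_0 fps \<Rightarrow> 'a \<Rightarrow> 'a fps"
  where "fps_general_power f x = fps_binomial x oo (f - 1)"

text \<open>
  Note that \<open>fps_ln 1\<close> is the series \<open>log (1 + t)\<close>, and that both quotients below are exact:
  numerator and denominator have order \<open>1\<close> in \<open>t\<close>.
\<close>

definition daehee_number :: "nat \<Rightarrow> nat \<Rightarrow> 'a::field_char_0"
  where "daehee_number k n = fact n * ((fps_ln 1 / fps_X) ^ k) $ n"

definition norlund_number :: "'a::field_char_0 \<Rightarrow> nat \<Rightarrow> 'a"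
  where "norlund_number x n = fps_general_power (fps_X / fps_ln 1) x $ n"

lemma daehee_number_gf:
  "Abs_fps (\<lambda>n. daehee_number k n / fact n) = (fps_ln 1 / fps_X :: 'a::field_char_0 fps) ^ k"
  by (simp add: fps_eq_iff daehee_number_def)

lemma norlund_number_gf:
  "Abs_fps (norlund_number x) = fps_general_power (fps_X / fps_ln 1) x"
  by (simp add: fps_eq_iff norlund_number_def)

lemma fps_ln_over_X_mult: "fps_ln 1 / fps_X * fps_X = (fps_ln 1 :: 'a::field_char_0 fps)"
  by (rule dvd_div_mult_self[OF fps_X_dvd_fps_ln])

lemma fps_ln_dvd_fps_X: "(fps_ln 1 :: 'a::field_char_0 fps) dvd fps_X"
proof -
  have "subdegree (fps_ln 1 :: 'a fps) = 1"
    by (rule subdegreeI) (auto simp: fps_ln_nth)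
  moreover have "fps_ln 1 \<noteq> (0 :: 'a fps)"
    using calculation by auto
  ultimately show ?thesis
    by (simp add: fps_dvd_iff)
qed

lemma X_over_fps_ln_mult: "fps_X / fps_ln 1 * fps_ln 1 = (fps_X :: 'a::field_char_0 fps)"
  by (rule dvd_div_mult_self[OF fps_ln_dvd_fps_X])

lemma X_over_fps_ln_nth_0: "(fps_X / fps_ln 1 :: 'a::field_char_0 fps) $ 0 = 1"
proof -
  have "(fps_X / fps_ln 1 * fps_ln 1 :: 'a fps) $ 1 = 1"
    by (subst X_over_fps_ln_mult) simp
  then show ?thesis
    by (simp add: fps_mult_nth fps_ln_nth)
qed

end

theory Submission
  imports Defs
begin

text \<open>The series \<open>fps_X / fps_ln 1\<close> and \<open>fps_ln 1 / fps_X\<close> are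
  mutually inverse. By \<open>fps_general_power_uminus_of_nat\<close>, the binomial-series power
  with exponent \<open>-k\<close> inverts the ordinary \<open>k\<close>-th power, so the two
  generating functions coincide.\<close>

lemma fps_general_power_uminus_of_nat:
  fixes f :: "'a::field_char_0 fps"
  assumes "f $ 0 = 1"
  shows "fps_general_power f (- of_nat k) * f ^ k = 1"
proof -
  have "fps_binomial (- of_nat k) * (1 + fps_X) ^ k = (1 :: 'a fps)"
    by (simp flip: fps_binomial_of_nat fps_binomial_add_mult)
  \<comment> \<open>Substituting \<open>f - 1\<close> for \<open>fps_X\<close> turns
    \<open>1 + fps_X\<close> into \<open>f\<close>; it respects products because
    \<open>f - 1\<close> has constant term 0.\<close>
  then have "(fps_binomial (- of_nat k) * (1 + fps_X) ^ k) oo (f - 1) = 1"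
    by simp
  then show ?thesis
    using assms
    by (simp add: fps_general_power_def fps_compose_mult_distrib fps_compose_add_distrib
        flip: fps_compose_power)
qed

theorem corollary2p2:
  fixes k m :: nat
  assumes "k \<ge> 1"
  shows "(daehee_number k m :: 'a::field_char_0) = fact m * norlund_number (- of_nat k) m"
proof -
  define f g :: "'a fps" where "f = fps_X / fps_ln 1" and "g = fps_ln 1 / fps_X"
  \<comment> \<open>The extra factor \<open>fps_X\<close> lets both exact quotients be multiplied
    out; it is then cancelled.\<close>
  have "f * g * fps_X = fps_X"
    unfolding f_def g_def by (simp only: mult.assoc fps_ln_over_X_mult X_over_fps_ln_mult)
  then have fg: "f * g = 1"
    by simp
  have "fps_general_power f (- of_nat k) = fps_general_power f (- of_nat k) * f ^ k * g ^ k"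
    by (simp add: mult.assoc fg flip: power_mult_distrib)
  also have "\<dots> = g ^ k"
    by (simp add: fps_general_power_uminus_of_nat f_def X_over_fps_ln_nth_0)
  finally show ?thesis
    by (simp add: daehee_number_def norlund_number_def f_def g_def)
qed

end
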